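(* Assume that the $\xi_n$ are i.i.d. Let $$\bar\mu=\frac1{\mathbb{E}m_0}\mathbb{E}\sum_{i=1}^NL_i\qquad\text{and}\qquad\bar\sigma^2=\frac1{\mathbb{E}m_0}\mathbb{E}\sum_{i=1}^N(L_i-\bar\mu)^2.$$ If $|\bar\mu|<\infty$ and $\bar\sigma^2\in(0,\infty)$, then for every $x\in\mathbb{R}$, $$\frac{\mathbb{E}Z_n(-\infty,\bar b_nx+\bar a_n]}{\mathbb{E}Z_n(\mathbb{R})}\to\Phi(x),$$ where $\bar a_n=n\bar\mu$ and $\bar b_n=\sqrt n\,\bar\sigma$.
   Context: Branching random walk in a random environment in time. Let $\xi=(\xi_n)_{n\ge 0}$ be a stationary and ergodic sequence of random variables with values in a measurable space $\Theta$; each realization of $\xi_n$ determines a probability distribution $\eta_n=\eta(\xi_n)$ on $\mathbb{N}\times\mathbb{R}\times\mathbb{R}\times\cdots$. Given $\xi$ (quenched law $\mathbb{P}_\xi$, expectation $\mathbb{E}_\xi$), let $X(u)=(N(u),L_1(u),L_2(u),\dots)$, indexed by finite sequences $u\in\{\emptyset\}\cup\bigcup_{n\ge1}\mathbb{N}^n$, be independent random vectors, $X(u)$ having law $\eta_n$ when the length $|u|$ equals $n$ (values $L_i(u)$ with $i>N(u)$ play no role). The initial particle $\emptyset$ is at $S_\emptyset=0$; each particle $u$ of generation $n$, located at $S_u$, is replaced by $N(u)$ particles $ui$ of generation $n+1$ located at $S_{ui}=S_u+L_i(u)$, $1\le i\le N(u)$. Let $\mathbb{T}_n$ be the set of particles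 of generation $n$ and $Z_n=\sum_{u\in\mathbb{T}_n}\delta_{S_u}$ their counting measure. The annealed law $\mathbb{P}$ (expectation $\mathbb{E}$) is $\mathbb{P}_\xi$ integrated against the law of $\xi$. Write $N=N(\emptyset)$, $L_i=L_i(\emptyset)$ and $m_n=\mathbb{E}_\xi N(u)$ for $|u|=n$. Standing assumption: $\mathbb{E}\log m_0\in(0,\infty)$ and $\mathbb{E}\frac{N}{m_0}\log^+N<\infty$. It is also understood that $\mathbb{E}m_0<\infty$, so that the normalizations make sense. $\Phi$ is the distribution function of the standard normal law. *)

theory Defs
  imports "HOL-Probability.Probability"
begin

text \<open>A value \<open>(N, L)\<close> of \<open>litter_space\<close> is the vector \<open>(N, L\<^sub>1, L\<^sub>2, \<dots>)\<close>; displacements are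
  indexed from 1. The argument \<open>x\<close> below is a full family of such vectors, indexed by finite
  sequences, and the child \<open>ui\<close> is the list \<open>u @ [i]\<close>.\<close>

type_synonym litter = "nat \<times> (nat \<Rightarrow> real)"

definition litter_space :: "litter measure" where
  "litter_space = count_space UNIV \<Otimes>\<^sub>M (\<Pi>\<^sub>M i\<in>{1..}. borel)"

primrec generation :: "(nat list \<Rightarrow> litter) \<Rightarrow> nat \<Rightarrow> nat list set" where
  "generation x 0 = {[]}"
| "generation x (Suc n) = {u @ [i] | u i. u \<in> generation x n \<and> 1 \<le> i \<and> i \<le> fst (x u)}"

fun position :: "(nat list \<Rightarrow> litter) \<Rightarrow> nat list \<Rightarrow> real" where
  "position x u =
    (if u = [] then 0 else position x (butlast u) + snd (x (butlast u)) (last u))"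

declare position.simps [simp del]

lemma position_Nil [simp]: "position x [] = 0"
  by (simp add: position.simps)

lemma position_snoc [simp]: "position x (u @ [i]) = position x u + snd (x u) i"
  by (subst position.simps) simp

lemma finite_generation: "finite (generation x n)"
proof (induction n)
  case (Suc n)
  have "generation x (Suc n) = (\<Union>u\<in>generation x n. (\<lambda>i. u @ [i]) ` {1..fst (x u)})"
    by auto
  with Suc show ?case by simp
qed simp

text \<open>The image of counting measure on generation \<open>n\<close> under the positions, that is, the sum of
  the Dirac masses \<open>\<delta>\<close> at the positions of the particles, with multiplicity.\<close>

definition population :: "(nat list \<Rightarrow> litter) \<Rightarrow> nat \<Rightarrow> real measure" where
  "population x n = distr (count_space (generation x n)) borel (position x)"

lemma measure_population:
  assumes "A \<in> sets borel"
  shows "measure (population x n) A = card {u \<in> generation x n. position x u \<in> A}"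
proof -
  have "measure (population x n) A =
      measure (count_space (generation x n)) (position x -` A \<inter> generation x n)"
    using assms by (simp add: population_def measure_distr)
  also have "\<dots> = card (position x -` A \<inter> generation x n)"
    by (subst measure_count_space) (auto simp: finite_generation)
  also have "position x -` A \<inter> generation x n = {u \<in> generation x n. position x u \<in> A}"
    by auto
  finally show ?thesis .
qed

text \<open>The conditional law of the whole family of vectors given the environment sequence \<open>e\<close>.\<close>

definition quenched_law ::
    "('t \<Rightarrow> litter measure) \<Rightarrow> (nat \<Rightarrow> 't) \<Rightarrow> (nat list \<Rightarrow> litter) measure" where
  "quenched_law \<eta> e = (\<Pi>\<^sub>M u\<in>UNIV. \<eta> (e (length u)))"

text \<open>The quenched expectation of \<open>N(u)\<close>, as a possibly infinite number. It depends on \<open>u\<close> only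
  through \<open>length u\<close>: for \<open>length u = n\<close> it is \<open>m\<^sub>n\<close>.\<close>

definition quenched_mean ::
    "('t \<Rightarrow> litter measure) \<Rightarrow> (nat \<Rightarrow> 't) \<Rightarrow> nat list \<Rightarrow> ennreal" where
  "quenched_mean \<eta> e u = (\<integral>\<^sup>+ x. of_nat (fst (x u)) \<partial>quenched_law \<eta> e)"

text \<open>\<open>M\<close> carries the annealed law: the last assumption says that the joint law of environment
  and family is the quenched law integrated against the law of the environment. No joint law of
  the environment sequence \<open>\<xi>\<close> itself is prescribed here.\<close>

locale branching_random_walk_in_random_environment = prob_space M
  for M :: "'a measure" +
  fixes \<Theta> :: "'t measure"
    and \<eta> :: "'t \<Rightarrow> litter measure"
    and \<xi> :: "nat \<Rightarrow> 'a \<Rightarrow> 't"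
    and X :: "nat list \<Rightarrow> 'a \<Rightarrow> litter"
  assumes measurable_eta: "\<eta> \<in> \<Theta> \<rightarrow>\<^sub>M prob_algebra litter_space"
    and measurable_xi: "\<And>n. \<xi> n \<in> M \<rightarrow>\<^sub>M \<Theta>"
    and measurable_X: "\<And>u. X u \<in> M \<rightarrow>\<^sub>M litter_space"
    and conditional_law:
      "\<And>B C. B \<in> sets (\<Pi>\<^sub>M n\<in>UNIV. \<Theta>) \<Longrightarrow> C \<in> sets (\<Pi>\<^sub>M u\<in>UNIV. litter_space) \<Longrightarrow>
        emeasure M {\<omega> \<in> space M. (\<lambda>n. \<xi> n \<omega>) \<in> B \<and> (\<lambda>u. X u \<omega>) \<in> C} =
        (\<integral>\<^sup>+ \<omega>. indicator B (\<lambda>n. \<xi> n \<omega>) * emeasure (quenched_law \<eta> (\<lambda>n. \<xi> n \<omega>)) C \<partial>M)"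

end

theory Submission
  imports Defs
begin

text \<open>Along a single ancestral line \<open>\<emptyset>, i\<^sub>1, i\<^sub>1i\<^sub>2, \<dots>\<close> the annealed reproduction vectors are i.i.d.,
  since the environments of distinct generations are. Conditioning on the last generation therefore
  shows that the intensity measure of \<open>Z\<^sub>n\<close> is \<open>(\<bbbE> m\<^sub>0)\<^sup>n\<close> times the \<open>n\<close>-fold convolution power of the
  probability measure \<open>\<nu>(A) = \<bbbE>(\<Sum>i\<le>N. 1\<^sub>A(L\<^sub>i)) / \<bbbE> m\<^sub>0\<close>, which has mean \<open>\<mu>\<close> and variance \<open>\<sigma>\<^sup>2\<close>.
  The claim is the classical central limit theorem for sums of i.i.d. variables with law \<open>\<nu>\<close>.\<close>

subsection \<open>Independence along an ancestral line\<close>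

context branching_random_walk_in_random_environment
begin

lemma prob_space_eta:
  assumes "\<omega> \<in> space M"
  shows "prob_space (\<eta> (\<xi> n \<omega>))" and "sets (\<eta> (\<xi> n \<omega>)) = sets litter_space"
  using measurable_space[OF measurable_eta measurable_space[OF measurable_xi assms], of n]
  by (auto simp: space_prob_algebra)

text \<open>With no restriction on the environment, \<open>conditional_law\<close> averages a
  quenched probability, and under the quenched law the vectors are independent, so a cylinder
  factorizes before the environment is averaged out. All later facts about the law of the vectors go
  back to this formula.\<close>

lemma emeasure_finite_cylinder:
  assumes J: "finite J" and A: "\<And>v. v \<in> J \<Longrightarrow> A v \<in> sets litter_space"
  shows "emeasure M {\<omega>\<in>space M. \<forall>v\<in>J. X v \<omega> \<in> A v} =
    (\<integral>\<^sup>+ \<omega>. (\<Prod>v\<in>J. emeasure (\<eta> (\<xi> (length v) \<omega>)) (A v)) \<partial>M)"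
proof -
  define C where "C = {x \<in> space (\<Pi>\<^sub>M u\<in>UNIV. litter_space). \<forall>v\<in>J. x v \<in> A v}"
  define B where "B = space (\<Pi>\<^sub>M n\<in>(UNIV :: nat set). \<Theta>)"
  have C: "C \<in> sets (\<Pi>\<^sub>M u\<in>UNIV. litter_space)"
    unfolding C_def using J A by (intro sets_Collect_single' sets.sets_Collect_finite_All) auto
  have "{\<omega>\<in>space M. \<forall>v\<in>J. X v \<omega> \<in> A v} =
      {\<omega>\<in>space M. (\<lambda>n. \<xi> n \<omega>) \<in> B \<and> (\<lambda>u. X u \<omega>) \<in> C}"
    using measurable_space[OF measurable_X] measurable_space[OF measurable_xi]
    by (auto simp: B_def C_def space_PiM)
  then have "emeasure M {\<omega>\<in>space M. \<forall>v\<in>J. X v \<omega> \<in> A v} =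
      (\<integral>\<^sup>+ \<omega>. indicator B (\<lambda>n. \<xi> n \<omega>) * emeasure (quenched_law \<eta> (\<lambda>n. \<xi> n \<omega>)) C \<partial>M)"
    using conditional_law[OF _ C, of B] by (simp add: B_def)
  also have "\<dots> = (\<integral>\<^sup>+ \<omega>. (\<Prod>v\<in>J. emeasure (\<eta> (\<xi> (length v) \<omega>)) (A v)) \<partial>M)"
  proof (rule nn_integral_cong)
    fix \<omega> assume \<omega>: "\<omega> \<in> space M"
    interpret P: product_prob_space "\<lambda>u. \<eta> (\<xi> (length u) \<omega>)" UNIV
      by (intro product_prob_spaceI prob_space_eta \<omega>)
    have "space (\<Pi>\<^sub>M u\<in>UNIV. litter_space) = space (\<Pi>\<^sub>M (u::nat list)\<in>UNIV. \<eta> (\<xi> (length u) \<omega>))"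
      by (intro sets_eq_imp_space_eq sets_PiM_cong) (auto simp: prob_space_eta[OF \<omega>])
    then have "emeasure (quenched_law \<eta> (\<lambda>n. \<xi> n \<omega>)) C =
        (\<Prod>v\<in>J. emeasure (\<eta> (\<xi> (length v) \<omega>)) (A v))"
      unfolding quenched_law_def C_def
      using P.emeasure_PiM_Collect[of J A] J A by (simp add: prob_space_eta[OF \<omega>])
    moreover have "(\<lambda>n. \<xi> n \<omega>) \<in> B"
      using measurable_space[OF measurable_xi \<omega>] by (auto simp: B_def space_PiM)
    ultimately show "indicator B (\<lambda>n. \<xi> n \<omega>) * emeasure (quenched_law \<eta> (\<lambda>n. \<xi> n \<omega>)) C =
        (\<Prod>v\<in>J. emeasure (\<eta> (\<xi> (length v) \<omega>)) (A v))" by simp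
  qed
  finally show ?thesis .
qed

lemma measurable_emeasure_eta:
  assumes "A \<in> sets litter_space"
  shows "(\<lambda>t. emeasure (\<eta> t) A) \<in> borel_measurable \<Theta>"
  by (rule measurable_emeasure_kernel[OF measurable_prob_algebraD[OF measurable_eta] assms])

lemma emeasure_X:
  assumes "A \<in> sets litter_space"
  shows "emeasure M {\<omega>\<in>space M. X u \<omega> \<in> A} = (\<integral>\<^sup>+ \<omega>. emeasure (\<eta> (\<xi> (length u) \<omega>)) A \<partial>M)"
  using emeasure_finite_cylinder[of "{u}" "\<lambda>_. A"] assms by simp

text \<open>The law of the root vector is the mixture of the kernels \<eta>(\<xi> 0), and each such
  kernel is the root marginal of the quenched law. With f the number of children this identifies the
  annealed mean of N with the mean of m_0.\<close>

lemma nn_integral_X_Nil: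
  assumes "f \<in> borel_measurable litter_space"
  shows "(\<integral>\<^sup>+ \<omega>. f (X [] \<omega>) \<partial>M) = (\<integral>\<^sup>+ \<omega>. (\<integral>\<^sup>+ x. f (x []) \<partial>quenched_law \<eta> (\<lambda>n. \<xi> n \<omega>)) \<partial>M)"
proof -
  have K: "(\<lambda>\<omega>. \<eta> (\<xi> 0 \<omega>)) \<in> M \<rightarrow>\<^sub>M subprob_algebra litter_space"
    using measurable_compose[OF measurable_xi measurable_prob_algebraD[OF measurable_eta]] .
  have "distr M litter_space (X []) = M \<bind> (\<lambda>\<omega>. \<eta> (\<xi> 0 \<omega>))"
  proof (rule measure_eqI)
    show "sets (distr M litter_space (X [])) = sets (M \<bind> (\<lambda>\<omega>. \<eta> (\<xi> 0 \<omega>)))"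
      by (subst sets_bind[where N=litter_space]) (auto simp: prob_space_eta not_empty)
    fix A assume "A \<in> sets (distr M litter_space (X []))"
    then have A: "A \<in> sets litter_space" by simp
    have "emeasure (distr M litter_space (X [])) A = emeasure M {\<omega>\<in>space M. X [] \<omega> \<in> A}"
      using A by (simp add: emeasure_distr measurable_X vimage_def Int_def conj_commute)
    also have "\<dots> = emeasure (M \<bind> (\<lambda>\<omega>. \<eta> (\<xi> 0 \<omega>))) A"
      using emeasure_X[OF A, of "[]"] by (simp add: emeasure_bind[OF not_empty K A])
    finally show "emeasure (distr M litter_space (X [])) A = emeasure (M \<bind> (\<lambda>\<omega>. \<eta> (\<xi> 0 \<omega>))) A" .
  qed
  moreover have "(\<integral>\<^sup>+ \<omega>. f (X [] \<omega>) \<partial>M) = (\<integral>\<^sup>+ y. f y \<partial>distr M litter_space (X []))"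
    using assms by (simp add: nn_integral_distr measurable_X)
  ultimately have "(\<integral>\<^sup>+ \<omega>. f (X [] \<omega>) \<partial>M) = (\<integral>\<^sup>+ y. f y \<partial>(M \<bind> (\<lambda>\<omega>. \<eta> (\<xi> 0 \<omega>))))"
    by simp
  also have "\<dots> = (\<integral>\<^sup>+ \<omega>. (\<integral>\<^sup>+ y. f y \<partial>\<eta> (\<xi> 0 \<omega>)) \<partial>M)"
    by (rule nn_integral_bind[OF assms K])
  also have "\<dots> = (\<integral>\<^sup>+ \<omega>. (\<integral>\<^sup>+ x. f (x []) \<partial>quenched_law \<eta> (\<lambda>n. \<xi> n \<omega>)) \<partial>M)"
  proof (rule nn_integral_cong)
    fix \<omega> assume \<omega>: "\<omega> \<in> space M"
    interpret P: product_prob_space "\<lambda>u. \<eta> (\<xi> (length u) \<omega>)" UNIV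
      by (intro product_prob_spaceI prob_space_eta \<omega>)
    have "f \<in> borel_measurable (\<eta> (\<xi> 0 \<omega>))"
      using assms prob_space_eta(2)[OF \<omega>] by (simp cong: measurable_cong_sets)
    then have "(\<integral>\<^sup>+ y. f y \<partial>distr (quenched_law \<eta> (\<lambda>n. \<xi> n \<omega>)) (\<eta> (\<xi> 0 \<omega>)) (\<lambda>x. x [])) =
        (\<integral>\<^sup>+ x. f (x []) \<partial>quenched_law \<eta> (\<lambda>n. \<xi> n \<omega>))"
      using measurable_component_singleton[of "[]" UNIV "\<lambda>u. \<eta> (\<xi> (length u) \<omega>)"]
      unfolding quenched_law_def by (intro nn_integral_distr) auto
    also have "distr (quenched_law \<eta> (\<lambda>n. \<xi> n \<omega>)) (\<eta> (\<xi> 0 \<omega>)) (\<lambda>x. x []) = \<eta> (\<xi> 0 \<omega>)"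
      using P.PiM_component[of "[]"] by (simp add: quenched_law_def)
    finally show "(\<integral>\<^sup>+ y. f y \<partial>\<eta> (\<xi> 0 \<omega>)) =
        (\<integral>\<^sup>+ x. f (x []) \<partial>quenched_law \<eta> (\<lambda>n. \<xi> n \<omega>))" .
  qed
  finally show ?thesis .
qed

text \<open>By \<open>emeasure_X\<close> the law of a vector is a mixture over the environment of
  its generation, and all these environments have the same law.\<close>

lemma distr_X:
  assumes ident: "\<And>n. distr M \<Theta> (\<xi> n) = distr M \<Theta> (\<xi> 0)"
  shows "distr M litter_space (X u) = distr M litter_space (X [])"
proof (rule measure_eqI)
  fix A assume "A \<in> sets (distr M litter_space (X u))"
  then have A: "A \<in> sets litter_space" by simp
  have "emeasure M {\<omega>\<in>space M. X v \<omega> \<in> A} = (\<integral>\<^sup>+ t. emeasure (\<eta> t) A \<partial>distr M \<Theta> (\<xi> 0))" for v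
    using emeasure_X[OF A, of v] measurable_emeasure_eta[OF A]
    by (simp add: ident[of "length v", symmetric] nn_integral_distr measurable_xi)
  then show "emeasure (distr M litter_space (X u)) A = emeasure (distr M litter_space (X [])) A"
    using A by (simp add: emeasure_distr measurable_X vimage_def Int_def conj_commute)
qed simp

text \<open>Particles of the same generation share their environment; only families with at most one
  index per generation are independent under the annealed law.\<close>

lemma indep_vars_X:
  assumes indep: "indep_vars (\<lambda>_. \<Theta>) \<xi> UNIV" and inj: "inj_on length I"
  shows "indep_vars (\<lambda>_. litter_space) X I"
  unfolding indep_vars_def2
proof (intro conjI ballI measurable_X indep_setsI)
  show "{X v -` A \<inter> space M | A. A \<in> sets litter_space} \<subseteq> events" for v
    using measurable_X by (auto intro: measurable_sets)
  fix C J assume J: "J \<noteq> {}" "J \<subseteq> I" "finite J"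
    and "\<forall>v\<in>J. C v \<in> {X v -` A \<inter> space M | A. A \<in> sets litter_space}"
  then have "\<forall>v\<in>J. \<exists>A. A \<in> sets litter_space \<and> C v = X v -` A \<inter> space M" by auto
  then obtain A where A: "\<And>v. v \<in> J \<Longrightarrow> A v \<in> sets litter_space"
      "\<And>v. v \<in> J \<Longrightarrow> C v = X v -` A v \<inter> space M" by metis
  have C: "C v = {\<omega>\<in>space M. X v \<omega> \<in> A v}" if "v \<in> J" for v
    using A(2)[OF that] by auto
  have injJ: "inj_on length J" using inj J by (auto intro: inj_on_subset)
  \<comment> \<open>Since lengths are distinct on \<open>J\<close>, a generation n determines the
    index \<open>k n\<close>. Products over \<open>J\<close> thus become products over generations,
    where the independence of the environments applies.\<close>
  define k where "k = the_inv_into J length"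
  have k: "k (length v) = v" if "v \<in> J" for v
    unfolding k_def by (rule the_inv_into_f_f[OF injJ that])
  have "indep_vars (\<lambda>_. borel) (\<lambda>n \<omega>. emeasure (\<eta> (\<xi> n \<omega>)) (A (k n))) (length ` J)"
    using indep_vars_subset[OF indep, of "length ` J"]
    by (rule indep_vars_compose2) (auto simp: k intro!: measurable_emeasure_eta A)
  then have *: "(\<integral>\<^sup>+ \<omega>. (\<Prod>n\<in>length ` J. emeasure (\<eta> (\<xi> n \<omega>)) (A (k n))) \<partial>M) =
      (\<Prod>n\<in>length ` J. \<integral>\<^sup>+ \<omega>. emeasure (\<eta> (\<xi> n \<omega>)) (A (k n)) \<partial>M)"
    using J by (intro indep_vars_nn_integral) auto
  have "(\<Inter>v\<in>J. C v) = {\<omega>\<in>space M. \<forall>v\<in>J. X v \<omega> \<in> A v}"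
    using C J by auto
  then have "emeasure M (\<Inter>v\<in>J. C v) =
      (\<integral>\<^sup>+ \<omega>. (\<Prod>v\<in>J. emeasure (\<eta> (\<xi> (length v) \<omega>)) (A v)) \<partial>M)"
    using emeasure_finite_cylinder[OF J(3) A(1)] by simp
  also have "\<dots> = (\<Prod>v\<in>J. \<integral>\<^sup>+ \<omega>. emeasure (\<eta> (\<xi> (length v) \<omega>)) (A v) \<partial>M)"
    using * by (simp add: prod.reindex[OF injJ] k cong: prod.cong)
  also have "\<dots> = (\<Prod>v\<in>J. emeasure M (C v))"
    by (intro prod.cong) (simp_all add: C emeasure_X A)
  finally show "prob (\<Inter>v\<in>J. C v) = (\<Prod>v\<in>J. prob (C v))"
    by (simp add: emeasure_eq_measure prod_ennreal prod_nonneg)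
qed

end

subsection \<open>Generations and the displacement law\<close>

text \<open>Whether u is born depends only on the vectors at proper prefixes of u.
  \<open>position_eq_sum\<close> shows the same for its location; together they make both
  independent of the vector at u itself.\<close>

lemma mem_generation_iff:
  "u \<in> generation x n \<longleftrightarrow> length u = n \<and> (\<forall>k<n. 1 \<le> u ! k \<and> u ! k \<le> fst (x (take k u)))"
proof (induction n arbitrary: u)
  case (Suc n)
  show ?case
  proof (cases u rule: rev_cases)
    case (snoc w i)
    then have "u \<in> generation x (Suc n) \<longleftrightarrow> w \<in> generation x n \<and> 1 \<le> i \<and> i \<le> fst (x w)"
      by auto
    also have "\<dots> \<longleftrightarrow> length u = Suc n \<and>
        (\<forall>k<Suc n. 1 \<le> u ! k \<and> u ! k \<le> fst (x (take k u)))"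
      unfolding Suc.IH using snoc by (auto simp: nth_append less_Suc_eq)
    finally show ?thesis .
  qed auto
qed auto

lemma position_eq_sum: "position x u = (\<Sum>k<length u. snd (x (take k u)) (u ! k))"
  by (induction u rule: rev_induct) (simp_all add: nth_append)

lemma sum_generation_Suc:
  "(\<Sum>v\<in>generation x (Suc n). f v) = (\<Sum>u\<in>generation x n. \<Sum>i=1..fst (x u). f (u @ [i]))"
proof -
  have *: "generation x (Suc n) =
      (\<lambda>(u, i). u @ [i]) ` (SIGMA u:generation x n. {1..fst (x u)})"
    by force
  have "(\<Sum>v\<in>generation x (Suc n). f v) =
      (\<Sum>p\<in>(SIGMA u:generation x n. {1..fst (x u)}). f (fst p @ [snd p]))"
    by (rule sum.reindex_cong[OF _ *]) (auto simp: inj_on_def)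
  then show ?thesis
    by (simp add: sum.Sigma finite_generation case_prod_beta)
qed

text \<open>Turns a sum over a random finite set into an integral over a fixed index set, so that
  expectation and summation can be exchanged by Tonelli.\<close>

lemma sum_eq_nn_integral_count_space:
  fixes h :: "'b \<Rightarrow> ennreal"
  assumes "finite A"
  shows "(\<Sum>u\<in>A. h u) = (\<integral>\<^sup>+ u. indicator A u * h u \<partial>count_space UNIV)"
  using assms
  by (simp add: nn_integral_count_space_finite[symmetric] nn_integral_count_space_indicator
      mult.commute)

section \<open>Measurability of functionals of vectors and particles\<close>

lemma measurable_fst_litter [measurable]: "fst \<in> litter_space \<rightarrow>\<^sub>M count_space UNIV"
  unfolding litter_space_def by measurable

lemma measurable_snd_litter:
  "1 \<le> i \<Longrightarrow> (\<lambda>y. snd y i) \<in> borel_measurable litter_space"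
  unfolding litter_space_def by measurable

text \<open>The number of summands is itself random: the sum is measurable for each fixed number n
  of summands, and these countably many versions are glued along \<open>fst y\<close>.\<close>

lemma borel_measurable_sum_litter:
  fixes h :: "'b \<times> real \<Rightarrow> ennreal"
  assumes h: "h \<in> borel_measurable (S \<Otimes>\<^sub>M borel)"
  shows "(\<lambda>(s, y). \<Sum>i=1..fst y. h (s, snd y i)) \<in> borel_measurable (S \<Otimes>\<^sub>M litter_space)"
proof -
  have "(\<lambda>sy. \<Sum>i=1..n. h (fst sy, snd (snd sy) i)) \<in> borel_measurable (S \<Otimes>\<^sub>M litter_space)" for n
  proof (rule borel_measurable_sum)
    fix i assume "i \<in> {1..n}"
    then have [measurable]: "(\<lambda>y. snd y i) \<in> borel_measurable litter_space"
      by (intro measurable_snd_litter) auto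
    note h [measurable]
    show "(\<lambda>sy. h (fst sy, snd (snd sy) i)) \<in> borel_measurable (S \<Otimes>\<^sub>M litter_space)"
      by measurable
  qed
  moreover have "(\<lambda>sy. fst (snd sy)) \<in> S \<Otimes>\<^sub>M litter_space \<rightarrow>\<^sub>M count_space UNIV"
    by measurable
  ultimately have "(\<lambda>sy. (\<lambda>n sy. \<Sum>i=1..n. h (fst sy, snd (snd sy) i)) (fst (snd sy)) sy)
      \<in> borel_measurable (S \<Otimes>\<^sub>M litter_space)"
    by (rule measurable_compose_countable)
  then show ?thesis by (simp add: case_prod_beta)
qed

lemma measurable_sum_litter:
  fixes f :: "real \<Rightarrow> ennreal"
  assumes f [measurable]: "f \<in> borel_measurable borel"
  shows "(\<lambda>y. \<Sum>i=1..fst y. f (snd y i)) \<in> borel_measurable litter_space"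
  using measurable_compose[OF measurable_Pair1' borel_measurable_sum_litter[of "\<lambda>(s, z). f z" "count_space UNIV"]]
  by simp

text \<open>The family \<open>Y\<close> is abstract because two instances occur: the full family on
  the probability space, and a family known only at the proper prefixes of u, living on a product
  space. \<open>Z\<close> stands for the vector at u.\<close>

lemma measurable_generation_position:
  assumes Y: "\<And>k. k < length u \<Longrightarrow> (\<lambda>y. Y y (take k u)) \<in> S \<rightarrow>\<^sub>M litter_space"
    and Z: "Z \<in> S \<rightarrow>\<^sub>M N" and g: "g \<in> borel_measurable (borel \<Otimes>\<^sub>M N)"
  shows "(\<lambda>y. indicator (generation (Y y) n) u * g (position (Y y) u, Z y) :: ennreal)
    \<in> borel_measurable S"
proof (cases "length u = n \<and> 0 \<notin> set u")
  \<comment> \<open>A list of the wrong length or with an entry 0 is never a particle. In the other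
    case all entries are at least 1, so only measurable coordinates of the displacements are
    read.\<close>
  case False
  then have "u \<notin> generation (Y y) n" for y
    unfolding mem_generation_iff by (metis in_set_conv_nth not_one_le_zero)
  then show ?thesis by simp
next
  case True
  then have nth: "1 \<le> u ! k" if "k < length u" for k
    using that by (metis in_set_conv_nth not_less_eq_eq One_nat_def le0 le_antisym)
  have 1: "(\<lambda>y. position (Y y) u) \<in> borel_measurable S"
    unfolding position_eq_sum
    by (intro borel_measurable_sum measurable_compose[OF Y measurable_snd_litter] nth) auto
  have "{y \<in> space S. \<forall>k\<in>{..<n}. u ! k \<le> fst (Y y (take k u))} \<in> sets S"
  proof (intro sets.sets_Collect_finite_All)
    fix k assume "k \<in> {..<n}"
    then have [measurable]: "(\<lambda>y. fst (Y y (take k u))) \<in> S \<rightarrow>\<^sub>M count_space UNIV"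
      using True by (intro measurable_compose[OF Y measurable_fst_litter]) auto
    show "{y \<in> space S. u ! k \<le> fst (Y y (take k u))} \<in> sets S"
      by measurable
  qed simp
  then have "(\<lambda>y. indicator {y \<in> space S. \<forall>k\<in>{..<n}. u ! k \<le> fst (Y y (take k u))} y :: ennreal)
      \<in> borel_measurable S" by simp
  also have "?this \<longleftrightarrow> (\<lambda>y. indicator (generation (Y y) n) u :: ennreal) \<in> borel_measurable S"
    using True nth by (intro measurable_cong) (auto simp: mem_generation_iff indicator_def)
  finally show ?thesis
    using measurable_compose[OF measurable_Pair[OF 1 Z] g] by simp
qed

section \<open>Integration over independent variables and product coordinates\<close>

text \<open>Tonelli for the product of the two laws. The map \<open>W\<close> is there because
  \<open>indep_var_restrict\<close> delivers the second variable as a function on a singleton index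
  set, from which \<open>W\<close> reads the value.\<close>

lemma (in prob_space) nn_integral_indep_var:
  assumes indep: "indep_var S U T V" and W: "W \<in> T \<rightarrow>\<^sub>M T'"
    and h: "h \<in> borel_measurable (S \<Otimes>\<^sub>M T')"
  shows "(\<integral>\<^sup>+ \<omega>. h (U \<omega>, W (V \<omega>)) \<partial>M) =
    (\<integral>\<^sup>+ \<omega>. (\<integral>\<^sup>+ y. h (U \<omega>, y) \<partial>distr M T' (\<lambda>\<omega>. W (V \<omega>))) \<partial>M)"
proof -
  have U: "U \<in> M \<rightarrow>\<^sub>M S" and V: "V \<in> M \<rightarrow>\<^sub>M T"
    and eq: "distr M S U \<Otimes>\<^sub>M distr M T V = distr M (S \<Otimes>\<^sub>M T) (\<lambda>x. (U x, V x))"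
    using indep unfolding indep_var_distribution_eq by auto
  interpret V: prob_space "distr M T V" by (rule prob_space_distr[OF V])
  have hW: "(\<lambda>p. h (fst p, W (snd p))) \<in> borel_measurable (S \<Otimes>\<^sub>M T)"
    using h W by measurable
  then have 1: "(\<lambda>p. h (fst p, W (snd p))) \<in> borel_measurable (distr M S U \<Otimes>\<^sub>M distr M T V)"
    and 2: "(\<lambda>p. h (fst p, W (snd p))) \<in> borel_measurable (S \<Otimes>\<^sub>M distr M T V)"
    by (simp_all cong: measurable_cong_sets sets_pair_measure_cong)
  have "(\<integral>\<^sup>+ \<omega>. h (U \<omega>, W (V \<omega>)) \<partial>M) =
      (\<integral>\<^sup>+ p. h (fst p, W (snd p)) \<partial>(distr M S U \<Otimes>\<^sub>M distr M T V))"
    unfolding eq using hW U V by (subst nn_integral_distr) auto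
  also have "\<dots> = (\<integral>\<^sup>+ s. (\<integral>\<^sup>+ y. h (s, W y) \<partial>distr M T V) \<partial>distr M S U)"
    using V.nn_integral_fst[OF 1] by simp
  also have "\<dots> = (\<integral>\<^sup>+ \<omega>. (\<integral>\<^sup>+ y. h (U \<omega>, W y) \<partial>distr M T V) \<partial>M)"
    using V.borel_measurable_nn_integral_fst[OF 2] U by (subst nn_integral_distr) auto
  also have "\<dots> = (\<integral>\<^sup>+ \<omega>. (\<integral>\<^sup>+ y. h (U \<omega>, y) \<partial>distr M T' (\<lambda>\<omega>. W (V \<omega>))) \<partial>M)"
  proof (rule nn_integral_cong)
    fix \<omega> assume "\<omega> \<in> space M"
    then have [measurable]: "(\<lambda>y. h (U \<omega>, y)) \<in> borel_measurable T'"
      using measurable_space[OF U] h by (auto intro: measurable_Pair2)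
    note U [measurable] V [measurable] W [measurable]
    show "(\<integral>\<^sup>+ y. h (U \<omega>, W y) \<partial>distr M T V) =
        (\<integral>\<^sup>+ y. h (U \<omega>, y) \<partial>distr M T' (\<lambda>\<omega>. W (V \<omega>)))"
      by (simp add: nn_integral_distr)
  qed
  finally show ?thesis .
qed

text \<open>Splits off the last increment of a random walk, the counterpart of passing from a
  particle to its children.\<close>

lemma (in prob_space) nn_integral_sum_iid:
  fixes f :: "real \<Rightarrow> ennreal"
  assumes indep: "indep_vars (\<lambda>_. borel) Y (UNIV :: nat set)" and f [measurable]: "f \<in> borel_measurable borel"
  shows "(\<integral>\<^sup>+ \<omega>. f (\<Sum>k<Suc n. Y k \<omega>) \<partial>M) =
    (\<integral>\<^sup>+ \<omega>. (\<integral>\<^sup>+ z. f ((\<Sum>k<n. Y k \<omega>) + z) \<partial>distr M borel (Y n)) \<partial>M)"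
proof -
  let ?R = "\<lambda>A \<omega>. restrict (\<lambda>k. Y k \<omega>) A"
  have "indep_var (PiM {..<n} (\<lambda>_. borel)) (?R {..<n}) (PiM {n} (\<lambda>_. borel)) (?R {n})"
    by (rule indep_var_restrict[OF indep]) auto
  then have "indep_var borel ((\<lambda>y. \<Sum>k<n. y k) \<circ> ?R {..<n}) borel ((\<lambda>y. y n) \<circ> ?R {n})"
    by (rule indep_var_compose) (auto intro!: borel_measurable_sum)
  then have "indep_var borel (\<lambda>\<omega>. \<Sum>k<n. Y k \<omega>) borel (Y n)"
    by (simp add: comp_def)
  from nn_integral_indep_var[OF this, of "\<lambda>z. z" borel "\<lambda>(s, z). f (s + z)"] show ?thesis
    by simp
qed

lemma distr_PiM_coordinate:
  assumes "prob_space \<nu>" "sets \<nu> = sets N"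
  shows "distr (PiM UNIV (\<lambda>_. \<nu>)) N (\<lambda>\<omega>. \<omega> n) = \<nu>"
proof -
  have "distr (PiM UNIV (\<lambda>_. \<nu>)) N (\<lambda>\<omega>. \<omega> n) = distr (PiM UNIV (\<lambda>_. \<nu>)) \<nu> (\<lambda>\<omega>. \<omega> n)"
    by (rule distr_cong) (simp_all add: assms)
  also have "\<dots> = \<nu>"
    by (rule distr_PiM_component) (simp_all add: assms)
  finally show ?thesis .
qed

text \<open>The joint law of the coordinates is the image of the product measure under the identity,
  hence the product of their marginals.\<close>

lemma indep_vars_PiM_coordinates:
  assumes "prob_space \<nu>" "sets \<nu> = sets N"
  shows "prob_space.indep_vars (PiM UNIV (\<lambda>_. \<nu>)) (\<lambda>_. N) (\<lambda>n \<omega>. \<omega> n) UNIV"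
proof -
  interpret prob_space "PiM UNIV (\<lambda>_. \<nu>)"
    by (intro prob_space_PiM assms)
  have rv: "(\<lambda>\<omega>. \<omega> n) \<in> PiM UNIV (\<lambda>_. \<nu>) \<rightarrow>\<^sub>M N" for n
    using measurable_component_singleton[of n UNIV "\<lambda>_. \<nu>"]
    by (simp add: measurable_cong_sets[OF refl assms(2)])
  have "distr (PiM UNIV (\<lambda>_. \<nu>)) (PiM UNIV (\<lambda>_. N)) (\<lambda>\<omega>. \<lambda>n\<in>UNIV. \<omega> n) =
      distr (PiM UNIV (\<lambda>_. \<nu>)) (PiM UNIV (\<lambda>_. \<nu>)) (\<lambda>\<omega>. \<omega>)"
    by (intro distr_cong sets_PiM_cong) (simp_all add: assms restrict_UNIV)
  then show ?thesis
    by (subst indep_vars_iff_distr_eq_PiM')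
       (simp_all add: rv distr_PiM_coordinate[OF assms] distr_id2)
qed

text \<open>Displacements are indexed from 1, and \<open>snd y 0\<close> is not a measurable function of \<open>y\<close>, hence the
  shift of the index.\<close>

definition displacement_law :: "litter measure \<Rightarrow> real measure" where
  "displacement_law K =
    distr (density (count_space UNIV \<Otimes>\<^sub>M K)
      (\<lambda>(i, y). indicator {..<fst y} i / (\<integral>\<^sup>+ y. of_nat (fst y) \<partial>K)))
      borel (\<lambda>(i, y). snd y (Suc i))"

lemma sets_displacement_law [simp, measurable_cong]: "sets (displacement_law K) = sets borel"
  by (simp add: displacement_law_def)

text \<open>The density draws a vector y with its law biased by the number of children, then a
  uniformly chosen child; the size bias cancels the uniform weight 1/N, leaving a plain sum over
  children. Division in \<open>ennreal\<close> is multiplication by the inverse, so the identity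
  also covers mean 0 and infinite mean.\<close>

lemma nn_integral_displacement_law:
  fixes f :: "real \<Rightarrow> ennreal"
  assumes K: "prob_space K" "sets K = sets litter_space" and f [measurable]: "f \<in> borel_measurable borel"
  shows "(\<integral>\<^sup>+ z. f z \<partial>displacement_law K) =
    (\<integral>\<^sup>+ y. (\<Sum>i=1..fst y. f (snd y i)) \<partial>K) / (\<integral>\<^sup>+ y. of_nat (fst y) \<partial>K)"
proof -
  interpret K: prob_space K by fact
  define c where "c = (\<integral>\<^sup>+ y. of_nat (fst y) \<partial>K)"
  have [measurable]: "fst \<in> K \<rightarrow>\<^sub>M count_space UNIV"
      "(\<lambda>y. snd y (Suc i)) \<in> borel_measurable K" for i
    using measurable_fst_litter measurable_snd_litter[of "Suc i"]
    by (simp_all add: measurable_cong_sets[OF K(2) refl])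
  have 1 [measurable]: "(\<lambda>(i, y). snd y (Suc i)) \<in> borel_measurable (count_space UNIV \<Otimes>\<^sub>M K)"
    by (rule measurable_pair_measure_countable1) auto
  have 2: "(\<lambda>(i, y). indicator {..<fst y} i / c)
      \<in> borel_measurable (count_space UNIV \<Otimes>\<^sub>M K)"
    by (rule measurable_pair_measure_countable1) (auto simp: indicator_def)
  have "(\<integral>\<^sup>+ z. f z \<partial>displacement_law K) =
      (\<integral>\<^sup>+ p. (case p of (i, y) \<Rightarrow> indicator {..<fst y} i / c) * f (case p of (i, y) \<Rightarrow> snd y (Suc i))
        \<partial>(count_space UNIV \<Otimes>\<^sub>M K))"
    using 1 2 unfolding displacement_law_def c_def[symmetric]
    by (simp add: nn_integral_distr nn_integral_density)
  also have "\<dots> = (\<integral>\<^sup>+ i. (\<integral>\<^sup>+ y. indicator {..<fst y} i / c * f (snd y (Suc i)) \<partial>K) \<partial>count_space UNIV)"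
    using 2 by (subst K.nn_integral_fst[symmetric]) auto
  also have "\<dots> = (\<integral>\<^sup>+ y. (\<integral>\<^sup>+ i. indicator {..<fst y} i / c * f (snd y (Suc i)) \<partial>count_space UNIV) \<partial>K)"
    by (rule nn_integral_count_space_nn_integral[symmetric]) (auto simp: indicator_def)
  also have "\<dots> = (\<integral>\<^sup>+ y. (\<Sum>i=1..fst y. f (snd y i)) / c \<partial>K)"
  proof (rule nn_integral_cong)
    fix y
    have "(\<Sum>i=1..fst y. f (snd y i)) / c = (\<Sum>i<fst y. f (snd y (Suc i)) / c)"
      by (simp add: sum.atLeast1_atMost_eq divide_ennreal_def sum_distrib_right)
    also have "\<dots> = (\<integral>\<^sup>+ i. indicator {..<fst y} i * (f (snd y (Suc i)) / c) \<partial>count_space UNIV)"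
      by (rule sum_eq_nn_integral_count_space) simp
    finally show "(\<integral>\<^sup>+ i. indicator {..<fst y} i / c * f (snd y (Suc i)) \<partial>count_space UNIV) =
        (\<Sum>i=1..fst y. f (snd y i)) / c"
      by (simp add: divide_ennreal_def mult_ac)
  qed
  also have "\<dots> = (\<integral>\<^sup>+ y. (\<Sum>i=1..fst y. f (snd y i)) \<partial>K) / c"
  proof (rule nn_integral_divide)
    show "(\<lambda>y. \<Sum>i=1..fst y. f (snd y i)) \<in> borel_measurable K"
      using measurable_sum_litter[OF f] by (simp add: measurable_cong_sets[OF K(2) refl])
  qed
  finally show ?thesis by (simp add: c_def)
qed

subsection \<open>The many-to-one formula\<close>

context branching_random_walk_in_random_environment
begin

lemma measurable_generation_term:
  assumes "g \<in> borel_measurable (borel \<Otimes>\<^sub>M litter_space)"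
  shows "(\<lambda>\<omega>. indicator (generation (\<lambda>v. X v \<omega>) n) u * g (position (\<lambda>v. X v \<omega>) u, X u \<omega>) :: ennreal)
    \<in> borel_measurable M"
  by (rule measurable_generation_position[OF _ measurable_X assms]) (rule measurable_X)

text \<open>The generation lies in the countable set of all lists, so the sum is an integral against
  counting measure: joint measurability needs checking only for each fixed u, and Tonelli exchanges
  the integrals.\<close>

lemma nn_integral_sum_generation:
  assumes "g \<in> borel_measurable (borel \<Otimes>\<^sub>M litter_space)"
  shows "(\<lambda>\<omega>. \<Sum>u\<in>generation (\<lambda>v. X v \<omega>) n. g (position (\<lambda>v. X v \<omega>) u, X u \<omega>)) \<in> borel_measurable M"
    and "(\<integral>\<^sup>+ \<omega>. (\<Sum>u\<in>generation (\<lambda>v. X v \<omega>) n. g (position (\<lambda>v. X v \<omega>) u, X u \<omega>)) \<partial>M) =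
      (\<integral>\<^sup>+ u. (\<integral>\<^sup>+ \<omega>. indicator (generation (\<lambda>v. X v \<omega>) n) u *
        g (position (\<lambda>v. X v \<omega>) u, X u \<omega>) \<partial>M) \<partial>count_space UNIV)"
proof -
  note meas = measurable_generation_term[OF assms, of n]
  interpret sigma_finite_measure "count_space (UNIV :: nat list set)"
    by (rule sigma_finite_measure_count_space_countable) simp
  have "(\<lambda>p. (\<lambda>u p. indicator (generation (\<lambda>v. X v (fst p)) n) u *
      g (position (\<lambda>v. X v (fst p)) u, X u (fst p)) :: ennreal) (snd p) p)
      \<in> borel_measurable (M \<Otimes>\<^sub>M count_space UNIV)"
    by (rule measurable_compose_countable[OF measurable_compose[OF measurable_fst meas]]) simp
  then show "(\<lambda>\<omega>. \<Sum>u\<in>generation (\<lambda>v. X v \<omega>) n. g (position (\<lambda>v. X v \<omega>) u, X u \<omega>)) \<in> borel_measurable M"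
    unfolding sum_eq_nn_integral_count_space[OF finite_generation]
    by (intro borel_measurable_nn_integral) (simp add: case_prod_beta)
  show "(\<integral>\<^sup>+ \<omega>. (\<Sum>u\<in>generation (\<lambda>v. X v \<omega>) n. g (position (\<lambda>v. X v \<omega>) u, X u \<omega>)) \<partial>M) =
      (\<integral>\<^sup>+ u. (\<integral>\<^sup>+ \<omega>. indicator (generation (\<lambda>v. X v \<omega>) n) u *
        g (position (\<lambda>v. X v \<omega>) u, X u \<omega>) \<partial>M) \<partial>count_space UNIV)"
    unfolding sum_eq_nn_integral_count_space[OF finite_generation]
    by (rule nn_integral_count_space_nn_integral) (auto intro: meas)
qed

text \<open>Birth and location of u are functions of the vectors at its proper prefixes. These
  prefixes and u have distinct lengths, so \<open>indep_vars_X\<close> makes the vector at u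
  independent of them, and it may be integrated out under its own law, which is that of the root
  vector.\<close>

lemma nn_integral_generation_indep:
  assumes indep: "indep_vars (\<lambda>_. \<Theta>) \<xi> UNIV"
    and ident: "\<And>n. distr M \<Theta> (\<xi> n) = distr M \<Theta> (\<xi> 0)"
    and g: "g \<in> borel_measurable (borel \<Otimes>\<^sub>M litter_space)"
  shows "(\<integral>\<^sup>+ \<omega>. indicator (generation (\<lambda>v. X v \<omega>) n) u * g (position (\<lambda>v. X v \<omega>) u, X u \<omega>) \<partial>M) =
    (\<integral>\<^sup>+ \<omega>. indicator (generation (\<lambda>v. X v \<omega>) n) u *
      (\<integral>\<^sup>+ y. g (position (\<lambda>v. X v \<omega>) u, y) \<partial>distr M litter_space (X [])) \<partial>M)"
proof (cases "length u = n")
  case False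
  then show ?thesis by (simp add: mem_generation_iff)
next
  case True
  define P where "P = (\<lambda>k. take k u) ` {..<length u}"
  define R where "R \<omega> = restrict (\<lambda>v. X v \<omega>) P" for \<omega>
  have length_P: "length v < length u" if "v \<in> P" for v
    using that by (auto simp: P_def)
  have uP: "u \<notin> P" using length_P by blast
  have take_P: "take k u \<in> P" if "k < length u" for k
    using that by (simp add: P_def)
  \<comment> \<open>Outside \<open>P\<close> the family \<open>R \<omega>\<close> is undefined, but
    neither membership nor position looks there.\<close>
  have R: "indicator (generation (R \<omega>) n) u = (indicator (generation (\<lambda>v. X v \<omega>) n) u :: ennreal)"
      "position (R \<omega>) u = position (\<lambda>v. X v \<omega>) u" for \<omega>
    using True take_P by (auto simp: R_def mem_generation_iff position_eq_sum indicator_def)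
  have "inj_on length (insert u P)"
    by (auto simp: P_def inj_on_def)
  then have "indep_vars (\<lambda>_. litter_space) X (insert u P)"
    by (rule indep_vars_X[OF indep])
  then have iv: "indep_var (PiM P (\<lambda>_. litter_space)) R (PiM {u} (\<lambda>_. litter_space))
      (\<lambda>\<omega>. restrict (\<lambda>v. X v \<omega>) {u})"
    unfolding R_def using uP by (intro indep_var_restrict) auto
  let ?h = "\<lambda>p. indicator (generation (fst p) n) u * g (position (fst p) u, snd p)"
  have h: "?h \<in> borel_measurable (PiM P (\<lambda>_. litter_space) \<Otimes>\<^sub>M litter_space)"
    by (rule measurable_generation_position[OF _ _ g])
       (auto intro!: measurable_compose[OF measurable_fst measurable_component_singleton] take_P)
  have "(\<integral>\<^sup>+ \<omega>. ?h (R \<omega>, X u \<omega>) \<partial>M) =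
      (\<integral>\<^sup>+ \<omega>. (\<integral>\<^sup>+ y. ?h (R \<omega>, y) \<partial>distr M litter_space (X [])) \<partial>M)"
    using nn_integral_indep_var[OF iv _ h, of "\<lambda>y. y u"] by (simp add: distr_X[OF ident, of u])
  also have "\<dots> = (\<integral>\<^sup>+ \<omega>. indicator (generation (\<lambda>v. X v \<omega>) n) u *
      (\<integral>\<^sup>+ y. g (position (\<lambda>v. X v \<omega>) u, y) \<partial>distr M litter_space (X [])) \<partial>M)"
  proof (rule nn_integral_cong)
    fix \<omega>
    show "(\<integral>\<^sup>+ y. ?h (R \<omega>, y) \<partial>distr M litter_space (X [])) =
      indicator (generation (\<lambda>v. X v \<omega>) n) u *
      (\<integral>\<^sup>+ y. g (position (\<lambda>v. X v \<omega>) u, y) \<partial>distr M litter_space (X []))"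
      using g by (simp add: R) (rule nn_integral_cmult, simp)
  qed
  finally show ?thesis by (simp add: R)
qed

lemma nn_integral_sum_generation_indep:
  assumes indep: "indep_vars (\<lambda>_. \<Theta>) \<xi> UNIV"
    and ident: "\<And>n. distr M \<Theta> (\<xi> n) = distr M \<Theta> (\<xi> 0)"
    and g: "g \<in> borel_measurable (borel \<Otimes>\<^sub>M litter_space)"
  shows "(\<integral>\<^sup>+ \<omega>. (\<Sum>u\<in>generation (\<lambda>v. X v \<omega>) n. g (position (\<lambda>v. X v \<omega>) u, X u \<omega>)) \<partial>M) =
    (\<integral>\<^sup>+ \<omega>. (\<Sum>u\<in>generation (\<lambda>v. X v \<omega>) n.
      (\<integral>\<^sup>+ y. g (position (\<lambda>v. X v \<omega>) u, y) \<partial>distr M litter_space (X []))) \<partial>M)"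
proof -
  interpret K: prob_space "distr M litter_space (X [])"
    by (rule prob_space_distr[OF measurable_X])
  have "g \<in> borel_measurable (borel \<Otimes>\<^sub>M distr M litter_space (X []))"
    using g by (simp cong: measurable_cong_sets sets_pair_measure_cong)
  then have [measurable]: "(\<lambda>s. \<integral>\<^sup>+ y. g (s, y) \<partial>distr M litter_space (X [])) \<in> borel_measurable borel"
    by (rule K.borel_measurable_nn_integral_fst)
  let ?F = "\<lambda>p. \<integral>\<^sup>+ y. g (fst p, y) \<partial>distr M litter_space (X [])"
  have "?F \<in> borel_measurable (borel \<Otimes>\<^sub>M litter_space)"
    by measurable
  from nn_integral_sum_generation(2)[OF this, of n] nn_integral_sum_generation(2)[OF g, of n]
  show ?thesis
    by (simp add: nn_integral_generation_indep[OF indep ident g])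
qed

text \<open>One generation contributes a factor c for the mean number of children and one increment
  with law \<nu>. The induction is over all f at once, because integrating out the last generation
  replaces f by another function of the location. The infinite product carries the walk for every
  n.\<close>

lemma many_to_one:
  fixes f :: "real \<Rightarrow> ennreal"
  defines "\<nu> \<equiv> displacement_law (distr M litter_space (X []))"
    and "c \<equiv> (\<integral>\<^sup>+ \<omega>. of_nat (fst (X [] \<omega>)) \<partial>M)"
  assumes indep: "indep_vars (\<lambda>_. \<Theta>) \<xi> UNIV"
    and ident: "\<And>n. distr M \<Theta> (\<xi> n) = distr M \<Theta> (\<xi> 0)"
    and c: "0 < c" "c < \<infinity>"
    and \<nu>: "prob_space \<nu>"
    and f: "f \<in> borel_measurable borel"
  shows "(\<integral>\<^sup>+ \<omega>. (\<Sum>u\<in>generation (\<lambda>v. X v \<omega>) n. f (position (\<lambda>v. X v \<omega>) u)) \<partial>M) =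
    c ^ n * (\<integral>\<^sup>+ \<omega>. f (\<Sum>k<n. \<omega> k) \<partial>PiM UNIV (\<lambda>_. \<nu>))"
  using f
proof (induction n arbitrary: f)
  case 0
  have "emeasure (PiM (UNIV :: nat set) (\<lambda>_. \<nu>)) (space (PiM UNIV (\<lambda>_. \<nu>))) = 1"
    by (intro prob_space.emeasure_space_1 prob_space_PiM \<nu>)
  then show ?case by (simp add: emeasure_space_1)
next
  case (Suc n)
  note Suc.prems [measurable]
  interpret P: prob_space "PiM (UNIV :: nat set) (\<lambda>_. \<nu>)"
    by (intro prob_space_PiM \<nu>)
  interpret N: prob_space \<nu> by fact
  let ?K = "distr M litter_space (X [])"
  \<comment> \<open>The total contribution of the children of a particle at s whose reproduction
    vector is y.\<close>
  let ?g = "\<lambda>(s, y). \<Sum>i=1..fst y. f (s + snd y i)"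
  have g: "?g \<in> borel_measurable (borel \<Otimes>\<^sub>M litter_space)"
    using borel_measurable_sum_litter[of "\<lambda>(s, z). f (s + z)" borel] by simp
  have c_eq: "c = (\<integral>\<^sup>+ y. of_nat (fst y) \<partial>?K)"
    unfolding c_def by (subst nn_integral_distr[OF measurable_X]) auto
  have sets_\<nu> [measurable_cong]: "sets \<nu> = sets borel" by (simp add: \<nu>_def)
  \<comment> \<open>Multiplying by c undoes the normalization in \<nu>; this is where c must be
    neither 0 nor infinite.\<close>
  have K: "(\<integral>\<^sup>+ y. ?g (s, y) \<partial>?K) = c * (\<integral>\<^sup>+ z. f (s + z) \<partial>\<nu>)" for s
    using nn_integral_displacement_law[of ?K "\<lambda>z. f (s + z)"] c ennreal_mult_divide_eq
    by (simp add: \<nu>_def prob_space_distr measurable_X c_eq[symmetric] ennreal_times_divide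
        mult.commute)
  have meas: "(\<lambda>s. \<integral>\<^sup>+ z. f (s + z) \<partial>\<nu>) \<in> borel_measurable borel"
    by measurable
  have indepP: "P.indep_vars (\<lambda>_. borel) (\<lambda>k \<omega>. \<omega> k) (UNIV :: nat set)"
    by (rule indep_vars_PiM_coordinates[OF \<nu> sets_\<nu>])
  have distrP: "distr (PiM (UNIV :: nat set) (\<lambda>_. \<nu>)) borel (\<lambda>\<omega>. \<omega> n) = \<nu>"
    by (rule distr_PiM_coordinate[OF \<nu> sets_\<nu>])
  have "(\<integral>\<^sup>+ \<omega>. (\<Sum>v\<in>generation (\<lambda>v. X v \<omega>) (Suc n). f (position (\<lambda>v. X v \<omega>) v)) \<partial>M) =
      (\<integral>\<^sup>+ \<omega>. (\<Sum>u\<in>generation (\<lambda>v. X v \<omega>) n. ?g (position (\<lambda>v. X v \<omega>) u, X u \<omega>)) \<partial>M)"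
    by (simp add: sum_generation_Suc del: generation.simps)
  also have "\<dots> = (\<integral>\<^sup>+ \<omega>. (\<Sum>u\<in>generation (\<lambda>v. X v \<omega>) n.
      c * (\<integral>\<^sup>+ z. f (position (\<lambda>v. X v \<omega>) u + z) \<partial>\<nu>)) \<partial>M)"
    unfolding nn_integral_sum_generation_indep[OF indep ident g] K ..
  \<comment> \<open>The induction hypothesis for the function mapping s to c times the \<nu>-average
    of f(s + z).\<close>
  also have "\<dots> = c ^ n * (\<integral>\<^sup>+ \<omega>. c * (\<integral>\<^sup>+ z. f ((\<Sum>k<n. \<omega> k) + z) \<partial>\<nu>) \<partial>PiM UNIV (\<lambda>_. \<nu>))"
    using meas by (intro Suc.IH) simp
  also have "\<dots> = c ^ Suc n * (\<integral>\<^sup>+ \<omega>. (\<integral>\<^sup>+ z. f ((\<Sum>k<n. \<omega> k) + z) \<partial>\<nu>) \<partial>PiM UNIV (\<lambda>_. \<nu>))"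
  proof -
    have "(\<lambda>\<omega>. \<integral>\<^sup>+ z. f ((\<Sum>k<n. \<omega> k) + z) \<partial>\<nu>) \<in> borel_measurable (PiM (UNIV :: nat set) (\<lambda>_. \<nu>))"
      by (rule measurable_compose[OF _ meas]) measurable
    then show ?thesis by (simp add: nn_integral_cmult mult_ac)
  qed
  also have "\<dots> = c ^ Suc n * (\<integral>\<^sup>+ \<omega>. f (\<Sum>k<Suc n. \<omega> k) \<partial>PiM UNIV (\<lambda>_. \<nu>))"
    unfolding P.nn_integral_sum_iid[OF indepP Suc.prems] distrP ..
  finally show ?case .
qed

text \<open>The many-to-one formula for indicators, transferred from \<open>ennreal\<close> to real
  expectations. Taking A to be the whole line gives the normalizing constant.\<close>

lemma expectation_population:
  fixes c :: real
  defines "\<nu> \<equiv> displacement_law (distr M litter_space (X []))"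
  assumes indep: "indep_vars (\<lambda>_. \<Theta>) \<xi> UNIV"
    and ident: "\<And>n. distr M \<Theta> (\<xi> n) = distr M \<Theta> (\<xi> 0)"
    and c: "0 < c" "(\<integral>\<^sup>+ \<omega>. of_nat (fst (X [] \<omega>)) \<partial>M) = ennreal c"
    and \<nu>: "prob_space \<nu>"
    and A: "A \<in> sets borel"
  shows "(\<integral>\<omega>. measure (population (\<lambda>u. X u \<omega>) n) A \<partial>M) =
    c ^ n * measure (PiM UNIV (\<lambda>_. \<nu>)) {\<omega> \<in> space (PiM UNIV (\<lambda>_. \<nu>)). (\<Sum>k<n. \<omega> k) \<in> A}"
proof -
  interpret P: prob_space "PiM (UNIV :: nat set) (\<lambda>_. \<nu>)"
    by (intro prob_space_PiM \<nu>)
  have [measurable_cong]: "sets \<nu> = sets borel" by (simp add: \<nu>_def)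
  let ?Z = "\<lambda>\<omega>. measure (population (\<lambda>u. X u \<omega>) n) A"
  let ?S = "{\<omega> \<in> space (PiM UNIV (\<lambda>_. \<nu>)). (\<Sum>k<n. \<omega> k) \<in> A}"
  have S: "?S \<in> sets (PiM UNIV (\<lambda>_. \<nu>))" using A by measurable
  have Z: "ennreal (?Z \<omega>) = (\<Sum>u\<in>generation (\<lambda>v. X v \<omega>) n. indicator A (position (\<lambda>v. X v \<omega>) u))" for \<omega>
    using A by (simp add: measure_population indicator_def sum.If_cases finite_generation
        Int_def ennreal_of_nat_eq_real_of_nat)
  have g: "(\<lambda>p. indicator A (fst p) :: ennreal) \<in> borel_measurable (borel \<Otimes>\<^sub>M litter_space)"
    using A by measurable
  have "(\<lambda>\<omega>. ennreal (?Z \<omega>)) \<in> borel_measurable M"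
    using nn_integral_sum_generation(1)[OF g] by (simp add: Z)
  then have "(\<lambda>\<omega>. enn2real (ennreal (?Z \<omega>))) \<in> borel_measurable M"
    by (rule borel_measurable_enn2real)
  then have "?Z \<in> borel_measurable M"
    by simp
  then have "(\<integral>\<omega>. ?Z \<omega> \<partial>M) = enn2real (\<integral>\<^sup>+ \<omega>. ennreal (?Z \<omega>) \<partial>M)"
    by (intro integral_eq_nn_integral) auto
  also have "(\<integral>\<^sup>+ \<omega>. ennreal (?Z \<omega>) \<partial>M) =
      ennreal c ^ n * (\<integral>\<^sup>+ \<omega>. indicator A (\<Sum>k<n. \<omega> k) \<partial>PiM UNIV (\<lambda>_. \<nu>))"
    unfolding Z c(2)[symmetric] \<nu>_def using c A \<nu>
    by (intro many_to_one[OF indep ident]) (auto simp: \<nu>_def)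
  also have "(\<integral>\<^sup>+ \<omega>. indicator A (\<Sum>k<n. \<omega> k) \<partial>PiM UNIV (\<lambda>_. \<nu>)) =
      (\<integral>\<^sup>+ \<omega>. indicator ?S \<omega> \<partial>PiM UNIV (\<lambda>_. \<nu>))"
    by (rule nn_integral_cong) (simp add: indicator_def)
  also have "\<dots> = ennreal (measure (PiM UNIV (\<lambda>_. \<nu>)) ?S)"
    using S by (simp add: P.emeasure_eq_measure)
  finally show ?thesis
    using c(1) by (simp add: enn2real_mult ennreal_power)
qed

section \<open>Total mass and moments of the displacement law\<close>

lemma nn_integral_displacement_law_X:
  fixes f :: "real \<Rightarrow> ennreal"
  assumes f: "f \<in> borel_measurable borel"
  shows "(\<integral>\<^sup>+ z. f z \<partial>displacement_law (distr M litter_space (X []))) =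
    (\<integral>\<^sup>+ \<omega>. (\<Sum>i=1..fst (X [] \<omega>). f (snd (X [] \<omega>) i)) \<partial>M) / (\<integral>\<^sup>+ \<omega>. of_nat (fst (X [] \<omega>)) \<partial>M)"
  using nn_integral_displacement_law[OF prob_space_distr[OF measurable_X] sets_distr f]
  by (simp add: nn_integral_distr[OF measurable_X] measurable_sum_litter[OF f] del: One_nat_def)

text \<open>For nonnegative h the two integrals differ by the positive finite factor c, so they are
  finite together.\<close>

lemma integral_displacement_law_nonneg:
  fixes h :: "real \<Rightarrow> real" and c :: real
  defines "\<nu> \<equiv> displacement_law (distr M litter_space (X []))"
    and "H \<equiv> \<lambda>\<omega>. \<Sum>i=1..fst (X [] \<omega>). h (snd (X [] \<omega>) i)"
  assumes c: "0 < c" "(\<integral>\<^sup>+ \<omega>. of_nat (fst (X [] \<omega>)) \<partial>M) = ennreal c"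
    and h [measurable]: "h \<in> borel_measurable borel" and h0: "\<And>z. 0 \<le> h z"
  shows "integrable \<nu> h \<longleftrightarrow> integrable M H" and "(\<integral>z. h z \<partial>\<nu>) = (\<integral>\<omega>. H \<omega> \<partial>M) / c"
proof -
  have H0: "0 \<le> H \<omega>" for \<omega> by (simp add: H_def sum_nonneg h0)
  have H: "ennreal (H \<omega>) = (\<Sum>i=1..fst (X [] \<omega>). ennreal (h (snd (X [] \<omega>) i)))" for \<omega>
    by (simp add: H_def h0)
  have "(\<lambda>\<omega>. ennreal (H \<omega>)) \<in> borel_measurable M"
    unfolding H
    by (rule measurable_compose[OF measurable_X measurable_sum_litter[of "\<lambda>z. ennreal (h z)"]]) simp
  then have "(\<lambda>\<omega>. enn2real (ennreal (H \<omega>))) \<in> borel_measurable M"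
    by (rule borel_measurable_enn2real)
  then have Hm: "H \<in> borel_measurable M" by (simp add: H0)
  have hm: "h \<in> borel_measurable \<nu>" unfolding \<nu>_def by measurable
  have eq: "(\<integral>\<^sup>+ z. ennreal (h z) \<partial>\<nu>) = (\<integral>\<^sup>+ \<omega>. ennreal (H \<omega>) \<partial>M) / ennreal c"
    unfolding \<nu>_def H c(2)[symmetric] by (rule nn_integral_displacement_law_X) simp
  have "(\<integral>\<^sup>+ z. ennreal (h z) \<partial>\<nu>) < \<infinity> \<longleftrightarrow> (\<integral>\<^sup>+ \<omega>. ennreal (H \<omega>) \<partial>M) < \<infinity>"
    unfolding eq using c(1) by (simp add: less_top[symmetric] ennreal_divide_eq_top_iff)
  then show "integrable \<nu> h \<longleftrightarrow> integrable M H"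
    by (simp add: integrable_iff_bounded hm Hm h0 H0)
  show "(\<integral>z. h z \<partial>\<nu>) = (\<integral>\<omega>. H \<omega> \<partial>M) / c"
    using c(1) by (simp add: integral_eq_nn_integral hm Hm h0 H0 eq divide_ennreal_def
        enn2real_mult inverse_ennreal field_simps)
qed

text \<open>For signed h, integrability is required under \<nu>: siblings may cancel, so the sum
  over children can be integrable while h is not. The proof subtracts the nonnegative cases for the
  positive and negative parts.\<close>

lemma integral_displacement_law:
  fixes h :: "real \<Rightarrow> real" and c :: real
  defines "\<nu> \<equiv> displacement_law (distr M litter_space (X []))"
  assumes c: "0 < c" "(\<integral>\<^sup>+ \<omega>. of_nat (fst (X [] \<omega>)) \<partial>M) = ennreal c"
    and h [measurable]: "h \<in> borel_measurable borel" and int: "integrable \<nu> h"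
  shows "(\<integral>z. h z \<partial>\<nu>) = (\<integral>\<omega>. (\<Sum>i=1..fst (X [] \<omega>). h (snd (X [] \<omega>) i)) \<partial>M) / c"
proof -
  define p where "p z = max 0 (h z)" for z
  define q where "q z = max 0 (- h z)" for z
  have h_eq: "h z = p z - q z" for z by (simp add: p_def q_def)
  have p: "integrable \<nu> p" and q: "integrable \<nu> q"
    unfolding p_def q_def using int by (auto intro: integrable_max)
  have pq: "p \<in> borel_measurable borel" "q \<in> borel_measurable borel" "0 \<le> p z" "0 \<le> q z" for z
    unfolding p_def q_def by auto
  note P = integral_displacement_law_nonneg[OF c pq(1,3), folded \<nu>_def]
  note Q = integral_displacement_law_nonneg[OF c pq(2,4), folded \<nu>_def]
  have "(\<integral>z. h z \<partial>\<nu>) = (\<integral>z. p z \<partial>\<nu>) - (\<integral>z. q z \<partial>\<nu>)"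
    unfolding h_eq using p q by (rule Bochner_Integration.integral_diff)
  also have "\<dots> = ((\<integral>\<omega>. (\<Sum>i=1..fst (X [] \<omega>). p (snd (X [] \<omega>) i)) \<partial>M) -
      (\<integral>\<omega>. (\<Sum>i=1..fst (X [] \<omega>). q (snd (X [] \<omega>) i)) \<partial>M)) / c"
    unfolding P(2) Q(2) by (simp add: diff_divide_distrib)
  also have "\<dots> = (\<integral>\<omega>. (\<Sum>i=1..fst (X [] \<omega>). p (snd (X [] \<omega>) i)) -
      (\<Sum>i=1..fst (X [] \<omega>). q (snd (X [] \<omega>) i)) \<partial>M) / c"
    using p q P(1) Q(1) by (subst Bochner_Integration.integral_diff) auto
  finally show ?thesis by (simp add: h_eq sum_subtractf)
qed

lemma prob_space_displacement_law:
  assumes "0 < (\<integral>\<^sup>+ \<omega>. of_nat (fst (X [] \<omega>)) \<partial>M)" "(\<integral>\<^sup>+ \<omega>. of_nat (fst (X [] \<omega>)) \<partial>M) < \<infinity>"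
  shows "prob_space (displacement_law (distr M litter_space (X [])))"
proof
  let ?\<nu> = "displacement_law (distr M litter_space (X []))"
  have "emeasure ?\<nu> (space ?\<nu>) = (\<integral>\<^sup>+ z. 1 \<partial>?\<nu>)" by simp
  \<comment> \<open>The constant function 1 gives the mean of N divided by itself, which is 1 since
    the mean is positive and finite.\<close>
  also have "\<dots> = 1"
    by (subst nn_integral_displacement_law_X) (use assms in \<open>auto simp: less_top[symmetric]\<close>)
  finally show "emeasure ?\<nu> (space ?\<nu>) = 1" .
qed

end

subsection \<open>The central limit theorem\<close>

text \<open>Weak convergence controls distribution functions only at continuity points; a law with a
  density has no atoms, so every point qualifies.\<close>

lemma isCont_cdf_std_normal: "isCont (cdf std_normal_distribution) x"
proof -
  interpret real_distribution std_normal_distribution by (rule real_dist_normal_dist)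
  have "AE y in lborel. y \<in> {x} \<longrightarrow> std_normal_density y = 0"
    using AE_lborel_singleton[of x] by eventually_elim auto
  then have "{x} \<in> null_sets std_normal_distribution"
    by (subst null_sets_density_iff) auto
  then show ?thesis
    unfolding isCont_cdf by (simp add: measure_def null_sets_def)
qed

lemma cdf_limit_iid_sums:
  fixes \<nu> :: "real measure" and \<mu> \<sigma> x :: real
  assumes \<nu>: "prob_space \<nu>" and sets_\<nu>: "sets \<nu> = sets borel"
    and \<sigma>: "0 < \<sigma>"
    and int: "integrable \<nu> (\<lambda>z. z)" "(\<integral>z. z \<partial>\<nu>) = \<mu>"
    and var: "integrable \<nu> (\<lambda>z. (z - \<mu>)\<^sup>2)" "(\<integral>z. (z - \<mu>)\<^sup>2 \<partial>\<nu>) = \<sigma>\<^sup>2"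
  shows "(\<lambda>n. measure (PiM UNIV (\<lambda>_. \<nu>)) {\<omega> \<in> space (PiM UNIV (\<lambda>_. \<nu>)).
      (\<Sum>k<n. \<omega> k) \<le> sqrt (real n) * \<sigma> * x + real n * \<mu>}) \<longlonglongrightarrow> cdf std_normal_distribution x"
proof -
  let ?P = "PiM (UNIV :: nat set) (\<lambda>_. \<nu>)"
  interpret prob_space ?P by (intro prob_space_PiM \<nu>)
  interpret N: prob_space \<nu> by fact
  note [measurable_cong] = sets_\<nu>
  have coord: "(\<lambda>\<omega>. \<omega> n) \<in> borel_measurable ?P" for n by measurable
  note distr = distr_PiM_coordinate[OF \<nu> sets_\<nu>]
  have integral: "(\<integral>\<omega>. h (\<omega> n) \<partial>?P) = (\<integral>z. h z \<partial>\<nu>)"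
    if "h \<in> borel_measurable borel" for h :: "real \<Rightarrow> real" and n
    using integral_distr[OF coord that, of n] by (simp add: distr)
  \<comment> \<open>The central limit theorem is applied with an uncentred second moment, recovered
    here by expanding the square.\<close>
  have sq: "integrable \<nu> (\<lambda>z. z\<^sup>2)"
  proof -
    have "integrable \<nu> (\<lambda>z. (z - \<mu>)\<^sup>2 + 2 * \<mu> * z - \<mu>\<^sup>2)"
      using int var by simp
    then show ?thesis by (simp add: power2_diff algebra_simps)
  qed
  have "weak_conv_m (\<lambda>n. distr ?P borel (\<lambda>\<omega>. (\<Sum>i<n. \<omega> i - \<mu>) / sqrt (n * \<sigma>\<^sup>2))) std_normal_distribution"
  proof (rule central_limit_theorem[where X="\<lambda>n \<omega>. \<omega> n" and \<mu>=\<nu>])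
    show "indep_vars (\<lambda>i. borel) (\<lambda>n \<omega>. \<omega> n) UNIV"
      by (rule indep_vars_PiM_coordinates[OF \<nu> sets_\<nu>])
    show "expectation (\<lambda>\<omega>. \<omega> n) = \<mu>" for n
      using integral[OF measurable_ident_sets[OF refl], of n] int(2) by (rule trans)
    then show "variance (\<lambda>\<omega>. \<omega> n) = \<sigma>\<^sup>2" for n
      using integral[of "\<lambda>z. (z - \<mu>)\<^sup>2" n] var by simp
    show "integrable ?P (\<lambda>\<omega>. (\<omega> n)\<^sup>2)" for n
      using integrable_distr_eq[OF coord[of n], of "\<lambda>z. z\<^sup>2"] sq by (simp add: distr)
  qed (use \<sigma> distr in auto)
  then have "(\<lambda>n. cdf (distr ?P borel (\<lambda>\<omega>. (\<Sum>i<n. \<omega> i - \<mu>) / sqrt (n * \<sigma>\<^sup>2))) x)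
      \<longlonglongrightarrow> cdf std_normal_distribution x"
    unfolding weak_conv_m_def weak_conv_def using isCont_cdf_std_normal by blast
  then show ?thesis
  proof (rule Lim_transform_eventually)
    show "\<forall>\<^sub>F n in sequentially.
        cdf (distr ?P borel (\<lambda>\<omega>. (\<Sum>i<n. \<omega> i - \<mu>) / sqrt (n * \<sigma>\<^sup>2))) x =
        prob {\<omega> \<in> space ?P. (\<Sum>k<n. \<omega> k) \<le> sqrt (real n) * \<sigma> * x + real n * \<mu>}"
      \<comment> \<open>For n = 0 the normalization is a division by 0, and the two events need not
        agree.\<close>
      using eventually_gt_at_top[of 0]
    proof eventually_elim
      case (elim n)
      have "(\<Sum>i<n. \<omega> i - \<mu>) / sqrt (n * \<sigma>\<^sup>2) \<le> x \<longleftrightarrow>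
          (\<Sum>k<n. \<omega> k) \<le> sqrt (real n) * \<sigma> * x + real n * \<mu>" for \<omega> :: "nat \<Rightarrow> real"
        using \<sigma> elim by (simp add: real_sqrt_mult sum_subtractf divide_le_eq algebra_simps)
      then show ?case
        unfolding cdf_def
        by (subst measure_distr) (auto intro!: arg_cong[where f=prob])
    qed
  qed
qed

theorem theorem9p2:
  fixes M :: "'a measure" and \<Theta> :: "'t measure"
    and \<eta> :: "'t \<Rightarrow> litter measure"
    and \<xi> :: "nat \<Rightarrow> 'a \<Rightarrow> 't"
    and X :: "nat list \<Rightarrow> 'a \<Rightarrow> litter"
    and N :: "'a \<Rightarrow> nat" and L :: "nat \<Rightarrow> 'a \<Rightarrow> real"
    and m0 :: "'a \<Rightarrow> ennreal" and Em0 \<mu> \<sigma> x :: real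
    and a b :: "nat \<Rightarrow> real"
  assumes brw: "branching_random_walk_in_random_environment M \<Theta> \<eta> \<xi> X"
    and indep: "prob_space.indep_vars M (\<lambda>_. \<Theta>) \<xi> UNIV"
    and ident: "\<And>n. distr M \<Theta> (\<xi> n) = distr M \<Theta> (\<xi> 0)"
    and N: "\<And>\<omega>. N \<omega> = fst (X [] \<omega>)"
    and L: "\<And>i \<omega>. L i \<omega> = snd (X [] \<omega>) i"
    and m0: "\<And>\<omega>. m0 \<omega> = quenched_mean \<eta> (\<lambda>n. \<xi> n \<omega>) []"
    and log_m0: "AE \<omega> in M. 0 < m0 \<omega> \<and> m0 \<omega> < \<infinity>"
      "integrable M (\<lambda>\<omega>. ln (enn2real (m0 \<omega>)))"
      "0 < (\<integral>\<omega>. ln (enn2real (m0 \<omega>)) \<partial>M)"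
    and NlogN: "(\<integral>\<^sup>+ \<omega>. of_nat (N \<omega>) / m0 \<omega> * ennreal (max 0 (ln (real (N \<omega>)))) \<partial>M) < \<infinity>"
    and Em0_finite: "(\<integral>\<^sup>+ \<omega>. m0 \<omega> \<partial>M) < \<infinity>"
    and Em0: "Em0 = enn2real (\<integral>\<^sup>+ \<omega>. m0 \<omega> \<partial>M)"
    and \<mu>_finite: "integrable M (\<lambda>\<omega>. \<Sum>i=1..N \<omega>. L i \<omega>)"
    and \<mu>: "\<mu> = 1 / Em0 * (\<integral>\<omega>. (\<Sum>i=1..N \<omega>. L i \<omega>) \<partial>M)"
    and \<sigma>_finite: "integrable M (\<lambda>\<omega>. \<Sum>i=1..N \<omega>. (L i \<omega> - \<mu>)\<^sup>2)"
    and \<sigma>: "\<sigma> = sqrt (1 / Em0 * (\<integral>\<omega>. (\<Sum>i=1..N \<omega>. (L i \<omega> - \<mu>)\<^sup>2) \<partial>M))"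
    and \<sigma>_pos: "\<sigma>\<^sup>2 > 0"
    and a: "\<And>n. a n = real n * \<mu>"
    and b: "\<And>n. b n = sqrt (real n) * \<sigma>"
  shows "(\<lambda>n. (\<integral>\<omega>. measure (population (\<lambda>u. X u \<omega>) n) {..b n * x + a n} \<partial>M) /
              (\<integral>\<omega>. measure (population (\<lambda>u. X u \<omega>) n) UNIV \<partial>M))
          \<longlonglongrightarrow> cdf std_normal_distribution x"
proof -
  interpret branching_random_walk_in_random_environment M \<Theta> \<eta> \<xi> X by fact
  define \<nu> where "\<nu> = displacement_law (distr M litter_space (X []))"
  have Em0_pos: "0 < Em0"
  proof -
    \<comment> \<open>If \<open>Em0\<close> were 0, then \<open>1 / Em0\<close> would be 0 by
      convention and \<sigma> would vanish.\<close>
    have "Em0 \<noteq> 0" using \<sigma> \<sigma>_pos by auto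
    then show ?thesis using Em0 by (simp add: order_less_le)
  qed
  have c: "(\<integral>\<^sup>+ \<omega>. of_nat (fst (X [] \<omega>)) \<partial>M) = ennreal Em0"
    using nn_integral_X_Nil[of "\<lambda>y. of_nat (fst y)"] Em0_finite
    by (simp add: Em0 m0 quenched_mean_def)
  have \<nu>: "prob_space \<nu>"
    unfolding \<nu>_def using c Em0_pos by (intro prob_space_displacement_law) auto
  have sets_\<nu>: "sets \<nu> = sets borel" by (simp add: \<nu>_def)
  interpret N: prob_space \<nu> by fact
  note [measurable_cong] = sets_\<nu>
  have \<sigma>': "0 < \<sigma>"
    using \<sigma>_pos \<sigma> Em0_pos by (simp add: order_less_le sum_nonneg integral_nonneg)
  have \<sigma>2: "\<sigma>\<^sup>2 = (\<integral>\<omega>. (\<Sum>i=1..N \<omega>. (L i \<omega> - \<mu>)\<^sup>2) \<partial>M) / Em0"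
    unfolding \<sigma> using Em0_pos by (simp add: sum_nonneg integral_nonneg)
  have var: "integrable \<nu> (\<lambda>z. (z - \<mu>)\<^sup>2)" "(\<integral>z. (z - \<mu>)\<^sup>2 \<partial>\<nu>) = \<sigma>\<^sup>2"
    using integral_displacement_law_nonneg[OF Em0_pos c, of "\<lambda>z. (z - \<mu>)\<^sup>2"] \<sigma>_finite
    by (simp_all add: \<nu>_def \<sigma>2 N L)
  \<comment> \<open>Under a probability measure a finite second moment gives a finite first moment.
    This supplies the integrability under \<nu> that \<open>integral_displacement_law\<close> asks
    for.\<close>
  have "integrable \<nu> (\<lambda>z. z - \<mu>)"
    using var(1) by (rule N.square_integrable_imp_integrable[rotated]) simp
  then have "integrable \<nu> (\<lambda>z. (z - \<mu>) + \<mu>)"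
    by (rule Bochner_Integration.integrable_add) simp
  then have int: "integrable \<nu> (\<lambda>z. z)" by simp
  then have mean: "(\<integral>z. z \<partial>\<nu>) = \<mu>"
    using integral_displacement_law[OF Em0_pos c measurable_ident_sets[OF refl], folded \<nu>_def]
    by (simp add: \<mu> N L)
  let ?P = "PiM (UNIV :: nat set) (\<lambda>_. \<nu>)"
  interpret P: prob_space ?P by (intro prob_space_PiM \<nu>)
  have Z: "(\<integral>\<omega>. measure (population (\<lambda>u. X u \<omega>) n) A \<partial>M) =
      Em0 ^ n * P.prob {\<omega> \<in> space ?P. (\<Sum>k<n. \<omega> k) \<in> A}" if "A \<in> sets borel" for n A
    using expectation_population[OF indep ident Em0_pos c _ that] \<nu> by (simp add: \<nu>_def)
  \<comment> \<open>Numerator and denominator share the factor \<open>Em0 ^ n\<close>, so the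
    quotient is exactly a distribution function of the walk, already for finite n.\<close>
  have "(\<integral>\<omega>. measure (population (\<lambda>u. X u \<omega>) n) {..b n * x + a n} \<partial>M) /
      (\<integral>\<omega>. measure (population (\<lambda>u. X u \<omega>) n) UNIV \<partial>M) =
      P.prob {\<omega> \<in> space ?P. (\<Sum>k<n. \<omega> k) \<le> sqrt (real n) * \<sigma> * x + real n * \<mu>}" for n
    using Em0_pos by (simp add: Z P.prob_space a b)
  then show ?thesis
    using cdf_limit_iid_sums[OF \<nu> sets_\<nu> \<sigma>' int mean var] by simp
qed

end
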